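(* Suppose that there exists a positive integer $q_0$ such that $$\left|\,?\left(\frac{p}{q}\right)-\frac{p}{q}\right|>\frac{1}{2q^2}$$ for all coprime positive integers $p,q$ with $p<q$ and $q\ge q_0$. Then the Minkowski question mark function $?:[0,1]\to[0,1]$ has exactly five fixed points, and exactly one irrational fixed point in the interval $(0,\frac12)$.
   Context: For positive integers $a_j$, $[a_1,a_2,\ldots]=\cfrac{1}{a_1+\cfrac{1}{a_2+\cdots}}$ denotes the (finite or infinite) continued fraction with zero integer part. The Minkowski question mark function $?:[0,1]\to[0,1]$ is defined by $?(0)=0$ and, for $x=[a_1,a_2,\ldots]\in(0,1]$, by $$?(x)=\sum_{k\ge 1}\frac{(-1)^{k+1}}{2^{a_1+\cdots+a_k-1}},$$ the sum being infinite if $x$ is irrational and finite (over all partial quotients) if $x$ is rational; the value does not depend on which of the two finite expansions of a rational number is used. The function $?$ is continuous and strictly increasing, and $?(1-x)=1-?(x)$ for all $x\in[0,1]$. A fixed point is a solution $x\in[0,1]$ of $?(x)=x$. *)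

theory Defs
  imports "HOL-Analysis.Analysis"
begin

text \<open>Finite continued fractions \<open>[a\<^sub>1, \<dots>, a\<^sub>n]\<close> with zero integer part.\<close>

fun cf :: "nat list \<Rightarrow> real" where
  "cf [] = 0"
| "cf (a # as) = 1 / (real a + cf as)"

text \<open>
  Partial quotients are indexed from 0, so \<open>a k\<close> is \<open>a\<^sub>k\<^sub>+\<^sub>1\<close> and the sign \<open>(-1)\<^sup>k\<^sup>+\<^sup>1\<close>
  of the usual formula becomes \<open>(-1)\<^sup>k\<close>. The truncated subtraction is harmless as long as
  all partial quotients are positive.
\<close>

definition qmark_term :: "(nat \<Rightarrow> nat) \<Rightarrow> nat \<Rightarrow> real" where
  "qmark_term a k = (-1) ^ k / 2 ^ ((\<Sum>i\<le>k. a i) - 1)"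

text \<open>
  \<open>qmark_rel x y\<close>: the number \<open>x\<close> has a finite or infinite continued fraction expansion
  with positive partial quotients for which the series has the value \<open>y\<close>. The empty
  expansion only represents \<open>0\<close>.
\<close>

definition qmark_rel :: "real \<Rightarrow> real \<Rightarrow> bool" where
  "qmark_rel x y \<longleftrightarrow>
     (\<exists>as. (\<forall>a\<in>set as. 0 < a) \<and> cf as = x \<and> y = (\<Sum>k<length as. qmark_term ((!) as) k)) \<or>
     (\<exists>a. (\<forall>i. 0 < a i) \<and> (\<lambda>n. cf (map a [0..<n])) \<longlonglongrightarrow> x \<and> qmark_term a sums y)"

text \<open>The Minkowski question mark function; only its values on \<open>[0,1]\<close> are meaningful.\<close>

definition qmark :: "real \<Rightarrow> real" where
  "qmark x = (if x = 0 then 0 else (THE y. qmark_rel x y))"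

subsection \<open>The definition is meaningful\<close>

lemma cf_bounds: "\<forall>a\<in>set as. 0 < a \<Longrightarrow> 0 \<le> cf as \<and> cf as \<le> 1"
proof (induction as)
  case (Cons a as)
  then have "1 \<le> real a + cf as" by (simp add: add_increasing2 Suc_le_eq)
  then show ?case by simp
qed simp

lemma cf_tail: "cf (map a [0..<Suc n]) = 1 / (real (a 0) + cf (map (\<lambda>i. a (Suc i)) [0..<n]))"
proof -
  have "[0..<Suc n] = 0 # map Suc [0..<n]" using upt_conv_Cons[of 0 "Suc n"] map_Suc_upt by simp
  then show ?thesis by (simp add: o_def del: upt_Suc)
qed

lemma qmark_term_0: "0 < a 0 \<Longrightarrow> qmark_term a 0 = 2 / 2 ^ a 0"
  by (cases "a 0") (auto simp: qmark_term_def)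

lemma qmark_term_Suc:
  assumes "0 < a 0" "0 < a (Suc 0)"
  shows "qmark_term a (Suc k) = - qmark_term (\<lambda>i. a (Suc i)) k / 2 ^ a 0"
proof -
  have s: "(\<Sum>i\<le>Suc k. a i) = a 0 + (\<Sum>i\<le>k. a (Suc i))"
    by (rule sum.atMost_Suc_shift)
  have "a (Suc 0) \<le> (\<Sum>i\<le>k. a (Suc i))"
    by (rule member_le_sum[of 0 "{..k}" "\<lambda>i. a (Suc i)", simplified])
  then have "(\<Sum>i\<le>Suc k. a i) - 1 = a 0 + ((\<Sum>i\<le>k. a (Suc i)) - 1)"
    using assms s by linarith
  then show ?thesis unfolding qmark_term_def by (simp add: power_add)
qed

lemma qmark_rel_step:
  assumes "qmark_rel x y" "x \<noteq> 0"
  obtains a x' y' where "0 < a" "qmark_rel x' y'" "0 \<le> x'" "x' \<le> 1"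
    "x = 1 / (real a + x')" "y = (2 - y') / 2 ^ a"
  using assms(1) unfolding qmark_rel_def
proof (elim disjE exE conjE)
  fix as assume as: "\<forall>a\<in>set as. 0 < a" "cf as = x" "y = (\<Sum>k<length as. qmark_term ((!) as) k)"
  then obtain b bs where [simp]: "as = b # bs" using assms(2) by (cases as) auto
  have b: "0 < b" "\<forall>a\<in>set bs. 0 < a" using as by auto
  define y' where "y' = (\<Sum>k<length bs. qmark_term ((!) bs) k)"
  have eq: "(\<lambda>i. as ! Suc i) = (!) bs" by auto
  have "y = qmark_term ((!) as) 0 + (\<Sum>k<length bs. qmark_term ((!) as) (Suc k))"
    using as by (simp add: sum.lessThan_Suc_shift del: sum.lessThan_Suc)
  also have "qmark_term ((!) as) 0 = 2 / 2 ^ b" using qmark_term_0[of "(!) as"] b by simp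
  also have "(\<Sum>k<length bs. qmark_term ((!) as) (Suc k)) =
      (\<Sum>k<length bs. - qmark_term ((!) bs) k / 2 ^ b)"
  proof (rule sum.cong)
    fix k assume "k \<in> {..<length bs}"
    then have "bs \<noteq> []" by auto
    then have "0 < bs ! 0" using b by (cases bs) auto
    then show "qmark_term ((!) as) (Suc k) = - qmark_term ((!) bs) k / 2 ^ b"
      using qmark_term_Suc[of "(!) as" k] b eq by simp
  qed simp
  also have "\<dots> = - y' / 2 ^ b"
    unfolding y'_def by (simp add: sum_negf sum_divide_distrib)
  finally have y: "y = (2 - y') / 2 ^ b" by (simp add: diff_divide_distrib)
  have "qmark_rel (cf bs) y'" unfolding qmark_rel_def using b y'_def by blast
  then show thesis using that[of b "cf bs" y'] b y cf_bounds[OF b(2)] as(2) by simp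
next
  fix a assume a: "\<forall>i. 0 < a i" "(\<lambda>n. cf (map a [0..<n])) \<longlonglongrightarrow> x" "qmark_term a sums y"
  define c where "c n = cf (map (\<lambda>i. a (Suc i)) [0..<n])" for n
  have c: "0 \<le> c n" "c n \<le> 1" for n using cf_bounds a(1) unfolding c_def by auto
  have "(\<lambda>n. cf (map a [0..<Suc n])) \<longlonglongrightarrow> x" using LIMSEQ_Suc[OF a(2)] .
  then have "(\<lambda>n. 1 / (real (a 0) + c n)) \<longlonglongrightarrow> x" unfolding cf_tail c_def .
  then have "(\<lambda>n. 1 / (1 / (real (a 0) + c n)) - real (a 0)) \<longlonglongrightarrow> 1 / x - real (a 0)"
    using assms(2) by (intro tendsto_intros)
  then have lim: "c \<longlonglongrightarrow> 1 / x - real (a 0)" by simp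
  define y' where "y' = 2 - 2 ^ a 0 * y"
  have "(\<lambda>k. qmark_term a (Suc k)) sums (y - qmark_term a 0)" using a(3) by (simp add: sums_Suc_iff)
  then have "(\<lambda>k. - qmark_term (\<lambda>i. a (Suc i)) k / 2 ^ a 0) sums (y - 2 / 2 ^ a 0)"
    using a(1) by (simp add: qmark_term_Suc qmark_term_0)
  from sums_mult[OF this, of "- (2 ^ a 0)"]
  have "(\<lambda>k. - (2 ^ a 0) * (- qmark_term (\<lambda>i. a (Suc i)) k / 2 ^ a 0)) sums
      (- (2 ^ a 0) * (y - 2 / 2 ^ a 0))" .
  moreover have "(\<lambda>k. - (2 ^ a 0) * (- qmark_term (\<lambda>i. a (Suc i)) k / 2 ^ a 0)) =
      qmark_term (\<lambda>i. a (Suc i))" by (rule ext) simp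
  moreover have "- (2 ^ a 0) * (y - 2 / 2 ^ a 0) = y'"
    unfolding y'_def right_diff_distrib by simp
  ultimately have "qmark_term (\<lambda>i. a (Suc i)) sums y'" by metis
  then have "qmark_rel (1 / x - real (a 0)) y'"
    using a(1) lim unfolding qmark_rel_def c_def[abs_def]
    by (intro disjI2 exI[of _ "\<lambda>i. a (Suc i)"]) auto
  moreover have "0 \<le> 1 / x - real (a 0)"
    by (rule LIMSEQ_le_const[OF lim]) (use c(1) in blast)
  moreover have "1 / x - real (a 0) \<le> 1"
    by (rule LIMSEQ_le_const2[OF lim]) (use c(2) in blast)
  moreover have "x = 1 / (real (a 0) + (1 / x - real (a 0)))" by simp
  moreover have "y = (2 - y') / 2 ^ a 0" unfolding y'_def by simp
  ultimately show thesis using that a(1) by blast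
qed

lemma qmark_rel_0: "qmark_rel 0 y \<Longrightarrow> y = 0"
  unfolding qmark_rel_def
proof (elim disjE exE conjE)
  fix as assume as: "\<forall>a\<in>set as. 0 < a" "cf as = 0" "y = (\<Sum>k<length as. qmark_term ((!) as) k)"
  show "y = 0"
  proof (cases as)
    case (Cons b bs)
    then have "0 < real b + cf bs" using as(1) cf_bounds[of bs] by (simp add: add_pos_nonneg)
    then show ?thesis using as(2) Cons by simp
  qed (use as in simp)
next
  fix a assume a: "\<forall>i. 0 < a i" "(\<lambda>n. cf (map a [0..<n])) \<longlonglongrightarrow> (0::real)"
  have "1 / (real (a 0) + 1) \<le> cf (map a [0..<n])" if "1 \<le> n" for n
  proof -
    obtain m where n: "n = Suc m" using \<open>1 \<le> n\<close> by (cases n) auto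
    have "0 \<le> cf (map (\<lambda>i. a (Suc i)) [0..<m]) \<and> cf (map (\<lambda>i. a (Suc i)) [0..<m]) \<le> 1"
      using a(1) by (intro cf_bounds) auto
    then show ?thesis unfolding n cf_tail using a(1)
      by (intro divide_left_mono) (auto intro!: mult_pos_pos add_pos_nonneg)
  qed
  then have "1 / (real (a 0) + 1) \<le> 0" by (intro LIMSEQ_le_const[OF a(2)]) blast
  then show "y = 0" by (simp add: divide_le_0_iff)
qed

lemma qmark_rel_1: "qmark_rel 1 y \<Longrightarrow> y = 1"
proof (erule qmark_rel_step)
  fix a x' y' assume h: "0 < a" "qmark_rel x' y'" "0 \<le> x'" "(1::real) = 1 / (real a + x')"
    "y = (2 - y') / 2 ^ a"
  then have "real a + x' = 1" by (simp add: field_simps)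
  with h have "a = 1" "x' = 0" by linarith+
  with h show "y = 1" using qmark_rel_0[of y'] by simp
qed simp

lemma abs_qmark_term_le:
  assumes "\<And>i. i \<le> k \<Longrightarrow> 0 < a i"
  shows "\<bar>qmark_term a k\<bar> \<le> (1 / 2) ^ k"
proof -
  have "(\<Sum>i\<le>k. 1) \<le> (\<Sum>i\<le>k. a i)" using assms by (intro sum_mono) (simp add: Suc_le_eq)
  then have "(2::real) ^ k \<le> 2 ^ ((\<Sum>i\<le>k. a i) - 1)" by (intro power_increasing) auto
  then have "1 / (2::real) ^ ((\<Sum>i\<le>k. a i) - 1) \<le> 1 / 2 ^ k" by (intro divide_left_mono) auto
  then show ?thesis by (simp add: qmark_term_def abs_divide power_abs power_one_over)
qed

lemma qmark_rel_abs_le: "qmark_rel x y \<Longrightarrow> \<bar>y\<bar> \<le> 2"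
  unfolding qmark_rel_def
proof (elim disjE exE conjE)
  fix as assume as: "\<forall>a\<in>set as. 0 < a" "y = (\<Sum>k<length as. qmark_term ((!) as) k)"
  have "\<bar>y\<bar> \<le> (\<Sum>k<length as. \<bar>qmark_term ((!) as) k\<bar>)" unfolding as(2) by (rule sum_abs)
  also have "\<dots> \<le> (\<Sum>k<length as. (1 / 2) ^ k)"
    using as(1) by (intro sum_mono abs_qmark_term_le) auto
  also have "\<dots> \<le> (\<Sum>k. (1 / 2) ^ k)" by (rule sum_le_suminf) auto
  finally show "\<bar>y\<bar> \<le> 2" by (simp add: suminf_geometric)
next
  fix a assume a: "\<forall>i. 0 < a i" "qmark_term a sums y"
  have b: "norm (qmark_term a k) \<le> (1 / 2) ^ k" for k using a(1) abs_qmark_term_le by simp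
  have s: "(\<lambda>k. (1 / 2 :: real) ^ k) sums 2" using geometric_sums[of "1 / 2 :: real"] by simp
  have "norm (suminf (qmark_term a)) \<le> (\<Sum>k. (1 / 2) ^ k)"
    by (rule norm_suminf_le[OF _ sums_summable[OF s]]) (rule b)
  then show "\<bar>y\<bar> \<le> 2" using sums_unique[OF a(2)] sums_unique[OF s] by simp
qed

lemma qmark_rel_diff_le: "qmark_rel x y \<Longrightarrow> qmark_rel x z \<Longrightarrow> \<bar>y - z\<bar> \<le> 4 / 2 ^ n"
proof (induction n arbitrary: x y z)
  case 0
  then show ?case using qmark_rel_abs_le[of x y] qmark_rel_abs_le[of x z] by simp
next
  case (Suc n)
  show ?case
  proof (cases "x = 0")
    case True
    then show ?thesis using Suc.prems qmark_rel_0[of y] qmark_rel_0[of z] by simp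
  next
    case False
    obtain a x' y' where 1: "0 < a" "qmark_rel x' y'" "0 \<le> x'" "x' \<le> 1"
      "x = 1 / (real a + x')" "y = (2 - y') / 2 ^ a"
      using qmark_rel_step[OF Suc.prems(1) False] .
    obtain b x'' z' where 2: "0 < b" "qmark_rel x'' z'" "0 \<le> x''" "x'' \<le> 1"
      "x = 1 / (real b + x'')" "z = (2 - z') / 2 ^ b"
      using qmark_rel_step[OF Suc.prems(2) False] .
    have eq: "real a + x' = real b + x''" using 1(5) 2(5) by simp
    have "a = b \<or> a = Suc b \<or> b = Suc a" using eq 1(3,4) 2(3,4) by linarith
    then consider "a = b" "x' = x''" | "a = Suc b" "x' = 0" "x'' = 1" | "b = Suc a" "x' = 1" "x'' = 0"
      using eq 1(3,4) 2(3,4) by force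
    then show ?thesis
    proof cases
      case 1
      have "\<bar>y' - z'\<bar> \<le> 4 / 2 ^ n" using Suc.IH \<open>qmark_rel x' y'\<close> \<open>qmark_rel x'' z'\<close> 1(2) by blast
      moreover have "(2::real) \<le> 2 ^ a" using \<open>0 < a\<close> power_increasing[of 1 a "2::real"] by simp
      ultimately have "\<bar>y' - z'\<bar> / 2 ^ a \<le> (4 / 2 ^ n) / 2" by (intro frac_le) auto
      moreover have "y - z = (z' - y') / 2 ^ a"
        using \<open>y = _\<close> \<open>z = _\<close> 1(1) by (simp add: diff_divide_distrib)
      then have "\<bar>y - z\<bar> = \<bar>y' - z'\<bar> / 2 ^ a" by (simp add: abs_divide abs_minus_commute)
      ultimately show ?thesis by simp
    next
      case 2
      have "y' = 0" "z' = 1"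
        using \<open>qmark_rel x' y'\<close> \<open>qmark_rel x'' z'\<close> 2 qmark_rel_0 qmark_rel_1 by blast+
      then show ?thesis using \<open>y = _\<close> \<open>z = _\<close> 2(1) by simp
    next
      case 3
      have "y' = 1" "z' = 0"
        using \<open>qmark_rel x' y'\<close> \<open>qmark_rel x'' z'\<close> 3 qmark_rel_0 qmark_rel_1 by blast+
      then show ?thesis using \<open>y = _\<close> \<open>z = _\<close> 3(1) by simp
    qed
  qed
qed

lemma qmark_rel_unique: "qmark_rel x y \<Longrightarrow> qmark_rel x z \<Longrightarrow> y = z"
proof -
  assume h: "qmark_rel x y" "qmark_rel x z"
  have "(\<lambda>n. 4 / 2 ^ n :: real) \<longlonglongrightarrow> 0"
    by (intro tendsto_divide_0[OF tendsto_const] filterlim_at_top_imp_at_infinity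
        filterlim_realpow_sequentially_gt1) auto
  then have "\<bar>y - z\<bar> \<le> 0" by (rule LIMSEQ_le_const) (use qmark_rel_diff_le[OF h] in blast)
  then show ?thesis by simp
qed

definition gauss_map :: "real \<Rightarrow> real" where
  "gauss_map x = (if x = 0 then 0 else frac (1 / x))"

lemma gauss_map_bounds: "0 \<le> gauss_map x" "gauss_map x < 1"
  by (auto simp: gauss_map_def frac_lt_1)

lemma gauss_map_decomp:
  assumes "0 < x" "x \<le> 1"
  shows "0 < nat \<lfloor>1 / x\<rfloor>" "x = 1 / (real (nat \<lfloor>1 / x\<rfloor>) + gauss_map x)"
proof -
  have "1 \<le> 1 / x" using assms by simp
  then have f: "1 \<le> \<lfloor>1 / x\<rfloor>" by linarith
  then show "0 < nat \<lfloor>1 / x\<rfloor>" by simp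
  have "real (nat \<lfloor>1 / x\<rfloor>) + gauss_map x = 1 / x"
    using assms f by (simp add: gauss_map_def frac_def of_nat_nat)
  then show "x = 1 / (real (nat \<lfloor>1 / x\<rfloor>) + gauss_map x)" by simp
qed

lemma cf_expansion_finite:
  "0 \<le> x \<Longrightarrow> x \<le> 1 \<Longrightarrow> (gauss_map ^^ n) x = 0 \<Longrightarrow> \<exists>as. (\<forall>a\<in>set as. 0 < a) \<and> cf as = x"
proof (induction n arbitrary: x)
  case 0
  then show ?case by (intro exI[of _ "[]"]) simp
next
  case (Suc n)
  show ?case
  proof (cases "x = 0")
    case True
    then show ?thesis by (intro exI[of _ "[]"]) simp
  next
    case False
    have "(gauss_map ^^ n) (gauss_map x) = 0" using Suc.prems(3) by (simp add: funpow_swap1)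
    then obtain as where as: "\<forall>a\<in>set as. 0 < a" "cf as = gauss_map x"
      using Suc.IH[of "gauss_map x"] gauss_map_bounds[of x] by auto
    have "0 < x" using False Suc.prems by simp
    note d = gauss_map_decomp[OF this Suc.prems(2)]
    show ?thesis using as d by (intro exI[of _ "nat \<lfloor>1 / x\<rfloor> # as"]) simp
  qed
qed

definition cf_digit :: "real \<Rightarrow> nat \<Rightarrow> nat" where
  "cf_digit x n = nat \<lfloor>1 / (gauss_map ^^ n) x\<rfloor>"

lemma two_step_contraction:
  fixes u v a b :: real
  assumes "1 \<le> a" "1 \<le> b" "0 \<le> u" "0 \<le> v"
  shows "\<bar>1 / (a + 1 / (b + u)) - 1 / (a + 1 / (b + v))\<bar> \<le> \<bar>u - v\<bar> / 4"
proof -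
  have *: "1 / (a + 1 / (b + w)) = (b + w) / (a * (b + w) + 1)" if "0 \<le> w" for w
  proof -
    have "b + w \<noteq> 0" using that assms by linarith
    then show ?thesis by (simp add: field_simps)
  qed
  have g: "2 \<le> a * (b + w) + 1" if "0 \<le> w" for w
    using mult_mono[of 1 a 1 "b + w"] that assms by simp
  define p q where "p = a * (b + u) + 1" and "q = a * (b + v) + 1"
  have pq: "2 \<le> p" "2 \<le> q" using g assms unfolding p_def q_def by auto
  then have "4 \<le> p * q" using mult_mono[of 2 p 2 q] by simp
  have "(b + u) / p - (b + v) / q = (u - v) / (p * q)"
    using pq by (simp add: diff_frac_eq) (simp add: p_def q_def algebra_simps)
  then have "1 / (a + 1 / (b + u)) - 1 / (a + 1 / (b + v)) = (u - v) / (p * q)"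
    using *[OF assms(3)] *[OF assms(4)] p_def q_def by simp
  moreover have "\<bar>u - v\<bar> / (p * q) \<le> \<bar>u - v\<bar> / 4" using \<open>4 \<le> p * q\<close> by (intro frac_le) auto
  moreover have "\<bar>p * q\<bar> = p * q" using \<open>4 \<le> p * q\<close> by simp
  ultimately show ?thesis by (simp only: abs_divide)
qed

lemma cf_digit_approx:
  assumes "\<And>k. 0 < (gauss_map ^^ k) x" "x \<le> 1"
  shows "\<bar>cf (map (cf_digit x) [0..<n]) - x\<bar> \<le> 2 / 2 ^ n"
  using assms
proof (induction n arbitrary: x rule: induct_nat_012)
  case 0
  then show ?case using "0.prems"(1)[of 0] by simp
next
  case 1
  have "0 < x" using "1.prems"(1)[of 0] by simp
  have p: "0 < cf_digit x 0" using gauss_map_decomp(1)[OF \<open>0 < x\<close>] "1.prems" by (simp add: cf_digit_def)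
  have "cf (map (cf_digit x) [0..<Suc 0]) = 1 / real (cf_digit x 0)" by simp
  moreover have "0 \<le> 1 / real (cf_digit x 0)" "1 / real (cf_digit x 0) \<le> 1" using p by auto
  ultimately have "\<bar>cf (map (cf_digit x) [0..<Suc 0]) - x\<bar> \<le> 1"
    using \<open>0 < x\<close> "1.prems"(2) by linarith
  then show ?case by simp
next
  case (ge2 n)
  define t where "t = gauss_map (gauss_map x)"
  have dig: "cf_digit x (Suc (Suc i)) = cf_digit t i" for i
    by (simp add: cf_digit_def t_def funpow_swap1)
  have x: "0 < x" and gx: "0 < gauss_map x" "gauss_map x \<le> 1"
    using ge2.prems(1)[of 0] ge2.prems(1)[of 1] gauss_map_bounds[of x] by auto
  define a b where "a = cf_digit x 0" and "b = cf_digit x 1"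
  have ab: "0 < a" "0 < b" "x = 1 / (real a + 1 / (real b + t))"
    using gauss_map_decomp[OF x ge2.prems(2)] gauss_map_decomp[OF gx]
    by (simp_all add: a_def b_def cf_digit_def t_def)
  have tt: "0 < (gauss_map ^^ k) t" for k
    using ge2.prems(1)[of "Suc (Suc k)"] by (simp add: t_def funpow_swap1)
  have pos: "0 < cf_digit t i" for i
  proof -
    have "(gauss_map ^^ i) t \<le> 1"
      using gauss_map_bounds t_def by (cases i) (auto intro: less_imp_le)
    then show ?thesis using gauss_map_decomp(1)[OF tt[of i]] by (simp add: cf_digit_def)
  qed
  let ?c = "cf (map (cf_digit t) [0..<n])"
  have c: "0 \<le> ?c" using cf_bounds[of "map (cf_digit t) [0..<n]"] pos by auto
  have "cf (map (cf_digit x) [0..<Suc (Suc n)]) = 1 / (real a + 1 / (real b + ?c))"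
    unfolding cf_tail dig by (simp add: a_def b_def)
  moreover have "\<bar>1 / (real a + 1 / (real b + ?c)) - 1 / (real a + 1 / (real b + t))\<bar> \<le> \<bar>?c - t\<bar> / 4"
    using ab c tt[of 0] by (intro two_step_contraction) auto
  moreover have "\<bar>?c - t\<bar> \<le> 2 / 2 ^ n"
    using gauss_map_bounds[of "gauss_map x"] by (intro ge2.IH(1) tt) (simp add: t_def)
  ultimately show ?case using ab(3) by simp
qed

lemma qmark_rel_exists:
  assumes "0 \<le> x" "x \<le> 1"
  shows "\<exists>y. qmark_rel x y"
proof (cases "\<exists>n. (gauss_map ^^ n) x = 0")
  case True
  then show ?thesis using cf_expansion_finite assms unfolding qmark_rel_def by blast
next
  case False
  have b: "0 < (gauss_map ^^ k) x \<and> (gauss_map ^^ k) x \<le> 1" for k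
  proof -
    have "0 \<le> (gauss_map ^^ k) x \<and> (gauss_map ^^ k) x \<le> 1"
      using assms gauss_map_bounds by (cases k) (auto intro: less_imp_le)
    moreover have "(gauss_map ^^ k) x \<noteq> 0" using False by blast
    ultimately show ?thesis by simp
  qed
  then have pos: "0 < cf_digit x k" for k
    unfolding cf_digit_def using gauss_map_decomp(1) by blast
  have "(\<lambda>n. cf (map (cf_digit x) [0..<n]) - x) \<longlonglongrightarrow> 0"
  proof (rule Lim_null_comparison)
    show "(\<lambda>n. 2 / 2 ^ n :: real) \<longlonglongrightarrow> 0"
    by (intro tendsto_divide_0[OF tendsto_const] filterlim_at_top_imp_at_infinity
        filterlim_realpow_sequentially_gt1) auto
    show "\<forall>\<^sub>F n in sequentially. norm (cf (map (cf_digit x) [0..<n]) - x) \<le> 2 / 2 ^ n"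
      using cf_digit_approx[of x] b assms by simp
  qed
  then have lim: "(\<lambda>n. cf (map (cf_digit x) [0..<n])) \<longlonglongrightarrow> x" by (simp add: LIM_zero_iff)
  have "summable (qmark_term (cf_digit x))"
    by (rule summable_comparison_test'[of "\<lambda>k. (1 / 2) ^ k" 0]) (use pos abs_qmark_term_le in auto)
  then obtain y where "qmark_term (cf_digit x) sums y" unfolding summable_def by blast
  then show ?thesis using lim pos unfolding qmark_rel_def by blast
qed

lemma qmark_eqI: "qmark_rel x y \<Longrightarrow> qmark x = y"
  unfolding qmark_def using qmark_rel_unique qmark_rel_0 by auto

lemma qmark_rel_qmark: "x \<in> {0..1} \<Longrightarrow> qmark_rel x (qmark x)"
  using qmark_rel_exists[of x] qmark_eqI by auto

lemma qmark_half: "qmark (1 / 2) = 1 / 2"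
proof (rule qmark_eqI)
  show "qmark_rel (1 / 2) (1 / 2)"
    unfolding qmark_rel_def by (intro disjI1 exI[of _ "[2]"]) (simp add: qmark_term_def)
qed

end

theory Submission
  imports Defs
begin

text \<open>
  Write \<open>?\<close> for the question mark function. The whole argument runs on its behaviour on Farey
  pairs, that is, on fractions \<open>p/q < p'/q'\<close> with \<open>p'q - pq' = 1\<close>: the value of \<open>?\<close> at the mediant
  \<open>(p+p')/(q+q')\<close> is the mean of its values at the two ends (\<open>qmark_mediant\<close>). This follows from
  the functional equations \<open>?(x/(1+x)) = ?(x)/2\<close> and \<open>?(1-x) = 1 - ?(x)\<close>, which also give
  monotonicity, continuity and the absence of rational fixed points other than \<open>0\<close>, \<open>1/2\<close>, \<open>1\<close>.
  A fixed point in \<open>(0,1/2)\<close> exists by the intermediate value theorem, because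
  \<open>?(1/4) = 1/8 < 1/4\<close> and \<open>?(3/7) = 7/16 > 3/7\<close>. By reflection it remains to see that it is the
  only one in \<open>(0,1/2)\<close>.

  The hypothesis forces the graph to cross the diagonal upwards at every irrational fixed point
  \<open>x\<close>: arbitrarily close to \<open>x\<close> there are points \<open>z > x\<close> with \<open>?(z) > z\<close> and, by reflection,
  points \<open>z < x\<close> with \<open>?(z) < z\<close>. To see this, take a narrow Farey pair \<open>l = p/q\<close>, \<open>r = p'/q'\<close>
  around \<open>x\<close> with \<open>x\<close> to the right of the mediant \<open>m\<close>, and suppose \<open>?(r) \<le> r\<close>. Then
  \<open>?(r) < r - 1/(2q'\<^sup>2)\<close>, and since \<open>?(r) \<ge> ?(x) = x\<close>, the distance from \<open>x\<close> to \<open>r\<close> exceeds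
  \<open>1/(2q'\<^sup>2)\<close>. This has two consequences.
  \<^item> As \<open>r - l = 1/(qq') \<le> 1/(2q\<^sup>2) + 1/(2q'\<^sup>2)\<close>, the point \<open>x\<close> is within \<open>1/(2q\<^sup>2)\<close> of \<open>l\<close>. The
    hypothesis at \<open>l\<close> therefore gives \<open>x - ?(l) > 1/(2q\<^sup>2)\<close>, so \<open>?(r) - ?(l) > 1/(2q\<^sup>2)\<close>.
  \<^item> The point \<open>x\<close> lies to the left of the mediant of \<open>m\<close> and \<open>r\<close>, whose distance to \<open>r\<close> is
    \<open>1/(q'(q+2q')) < 1/(2q'\<^sup>2)\<close>. Hence a quarter of \<open>?(r) - ?(l)\<close> is at most
    \<open>?(r) - x < (r - m) - 1/(2q'\<^sup>2)\<close>.

  Together, \<open>1/(8q\<^sup>2) < 1/(q'(q+q')) - 1/(2q'\<^sup>2)\<close>, which rearranges to the absurdity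
  \<open>q'\<^sup>3 + q(q'-2q)\<^sup>2 < 0\<close>. This is \<open>above_diagonal_at_right_endpoint\<close>.

  Two fixed points \<open>x < y\<close> in \<open>(0,1/2)\<close> are then impossible: just after \<open>x\<close> there is a point \<open>z\<close>
  above the diagonal, and the first fixed point after \<open>z\<close>, being irrational as well, would have
  points below the diagonal just before it; between \<open>z\<close> and such a point there is a still earlier
  fixed point.
\<close>

section \<open>Functional equations\<close>

lemma const_over_power_two_tendsto_0: "(\<lambda>n. c / 2 ^ n :: real) \<longlonglongrightarrow> 0"
  by (intro tendsto_divide_0[OF tendsto_const] filterlim_at_top_imp_at_infinity
      filterlim_realpow_sequentially_gt1) auto

lemma qmark_0: "qmark 0 = 0"
  by (simp add: qmark_def)

lemma qmark_1: "qmark 1 = 1"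
  using qmark_rel_qmark[of 1] qmark_rel_1 by simp

lemma qmark_cf_step:
  assumes "0 < a" "0 \<le> x" "x \<le> 1"
  shows "qmark (1 / (real a + x)) = (2 - qmark x) / 2 ^ a"
proof -
  define z where "z = 1 / (real a + x)"
  have z: "0 < z" "z \<le> 1" using assms by (auto simp: z_def)
  obtain b x' y' where b: "0 < b" "qmark_rel x' y'" "0 \<le> x'" "x' \<le> 1"
    "z = 1 / (real b + x')" "qmark z = (2 - y') / 2 ^ b"
    by (rule qmark_rel_step[OF qmark_rel_qmark[of z]]) (use z in auto)
  have y': "y' = qmark x'" using qmark_eqI[OF b(2)] by simp
  have eq: "real a + x = real b + x'" using b(5) unfolding z_def by simp
  \<comment> \<open>The leading partial quotient is only determined up to the ambiguity \<open>a + 1 = (a + 1) + 0\<close>.\<close>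
  have "a = b \<or> a = Suc b \<or> b = Suc a" using eq assms b(3,4) by linarith
  then consider "a = b" "x = x'" | "a = Suc b" "x = 0" "x' = 1" | "b = Suc a" "x = 1" "x' = 0"
    using eq assms b(3,4) by force
  then show ?thesis
    using b(6) unfolding y' z_def[symmetric] by cases (auto simp: qmark_0 qmark_1)
qed

text \<open>
  The equation \<open>?(v/(1+v)) = ?(v)/2\<close>, solved for \<open>u = v/(1+v)\<close>: if \<open>v = 1/(a+t)\<close>, then
  \<open>u = 1/(a+1+t)\<close>, so passing from \<open>v\<close> to \<open>u\<close> raises the first partial quotient by one.
\<close>

lemma qmark_lower_half:
  assumes "0 \<le> u" "u \<le> 1 / 2"
  shows "qmark u = qmark (u / (1 - u)) / 2"
proof (cases "u = 0")
  case False
  define v where "v = u / (1 - u)"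
  have v: "0 < v" "v \<le> 1" using assms False by (auto simp: v_def field_simps)
  define a where "a = nat \<lfloor>1 / v\<rfloor>"
  note d = gauss_map_decomp[OF v, folded a_def] gauss_map_bounds[of v]
  have "1 / u = 1 + 1 / v" using False assms by (simp add: v_def field_simps)
  also have "1 / v = real a + gauss_map v" using d(2) by (metis div_by_1 divide_divide_eq_right mult_1)
  finally have "1 / u = real (Suc a) + gauss_map v" by simp
  then have u: "u = 1 / (real (Suc a) + gauss_map v)"
    by (metis div_by_1 divide_divide_eq_right mult_1)
  have g: "0 \<le> gauss_map v" "gauss_map v \<le> 1" using gauss_map_bounds[of v] by auto
  have "qmark v = (2 - qmark (gauss_map v)) / 2 ^ a"
    using qmark_cf_step[OF d(1) g] unfolding d(2)[symmetric] .
  moreover have "qmark u = (2 - qmark (gauss_map v)) / 2 ^ Suc a"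
    using qmark_cf_step[OF _ g, of "Suc a"] unfolding u[symmetric] by simp
  ultimately show ?thesis unfolding v_def[symmetric] by simp
qed (simp add: qmark_0)

lemma qmark_fraction_lower_half:
  assumes "c \<le> t" "0 < t"
  shows "qmark (real c / real (c + t)) = qmark (real c / real t) / 2"
proof -
  have eq: "1 - real c / real (c + t) = real t / real (c + t)"
    using assms by (simp add: diff_divide_eq_iff)
  have "real c / real (c + t) / (1 - real c / real (c + t)) = real c / real t"
    unfolding eq using assms by simp
  moreover have "0 \<le> real c / real (c + t)" "real c / real (c + t) \<le> 1 / 2"
    using assms by (auto simp: field_simps)
  ultimately show ?thesis using qmark_lower_half by metis
qed

lemma qmark_reflect:
  assumes "0 \<le> u" "u \<le> 1"
  shows "qmark (1 - u) = 1 - qmark u"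
proof -
  have *: "qmark (1 - u) = 1 - qmark u" if "0 \<le> u" "u \<le> 1 / 2" for u :: real
  proof -
    define v where "v = u / (1 - u)"
    have v: "0 \<le> v" "v \<le> 1" using that by (auto simp: v_def field_simps)
    \<comment> \<open>The first partial quotient of \<open>1 - u\<close> is \<open>1\<close>.\<close>
    have "1 - u = 1 / (real 1 + v)" using that by (simp add: v_def field_simps)
    then show ?thesis
      using qmark_cf_step[of 1 v] v qmark_lower_half[OF that] unfolding v_def[symmetric] by simp
  qed
  show ?thesis using *[of u] *[of "1 - u"] assms by (cases "u \<le> 1 / 2") auto
qed

section \<open>Monotonicity and continuity\<close>

text \<open>
  The bounds of this section are proved by halving: the equations on the lower half and the
  reflection reduce an estimate to the same estimate with half the error.
\<close>

lemma qmark_range: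
  assumes "0 \<le> x" "x \<le> 1"
  shows "0 \<le> qmark x" "qmark x \<le> 1"
proof -
  have *: "- (2 / 2 ^ n) \<le> qmark x \<and> qmark x \<le> 1 + 2 / 2 ^ n" if "0 \<le> x" "x \<le> 1" for n x
    using that
  proof (induction n arbitrary: x)
    case 0
    then have "\<bar>qmark x\<bar> \<le> 2" using qmark_rel_abs_le[OF qmark_rel_qmark[of x]] by simp
    then show ?case by (simp add: abs_le_iff)
  next
    case (Suc n)
    have low: "- (2 / 2 ^ Suc n) \<le> qmark u \<and> qmark u \<le> 1 / 2 + 2 / 2 ^ Suc n"
      if "0 \<le> u" "u \<le> 1 / 2" for u
      using Suc.IH[of "u / (1 - u)"] that unfolding qmark_lower_half[OF that]
      by (simp add: field_simps)
    have "0 < 2 / (2::real) ^ Suc n" by simp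
    then show ?case
      using low[of x] low[of "1 - x"] Suc.prems qmark_reflect[of x]
      by (cases "x \<le> 1 / 2") auto
  qed
  note lim = const_over_power_two_tendsto_0[of 2]
  have l1: "(\<lambda>n. - (2 / 2 ^ n) :: real) \<longlonglongrightarrow> 0" using tendsto_minus[OF lim] by simp
  have l2: "(\<lambda>n. 1 + 2 / 2 ^ n :: real) \<longlonglongrightarrow> 1" using tendsto_add[OF tendsto_const lim] by simp
  show "0 \<le> qmark x" using LIMSEQ_le_const2[OF l1] * assms by blast
  show "qmark x \<le> 1" using LIMSEQ_le_const[OF l2] * assms by blast
qed

lemma qmark_lower_half_le: "0 \<le> x \<Longrightarrow> x \<le> 1 / 2 \<Longrightarrow> qmark x \<le> 1 / 2"
  using qmark_lower_half[of x] qmark_range[of "x / (1 - x)"] by (simp add: field_simps)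

lemma qmark_upper_half_ge: "1 / 2 \<le> x \<Longrightarrow> x \<le> 1 \<Longrightarrow> 1 / 2 \<le> qmark x"
  using qmark_lower_half_le[of "1 - x"] qmark_reflect[of x] by simp

lemma unfold_lower_half_mono:
  fixes x y :: real
  assumes "0 \<le> x" "x \<le> y" "y \<le> 1 / 2"
  shows "x / (1 - x) \<le> y / (1 - y)"
  using assms by (intro frac_le) auto

lemma qmark_mono:
  assumes "0 \<le> x" "x \<le> y" "y \<le> 1"
  shows "qmark x \<le> qmark y"
proof -
  have *: "qmark x \<le> qmark y + 1 / 2 ^ n" if "0 \<le> x" "x \<le> y" "y \<le> 1" for n x y
    using that
  proof (induction n arbitrary: x y)
    case 0
    then show ?case using qmark_range[of x] qmark_range[of y] by simp
  next
    case (Suc n)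
    have low: "qmark u \<le> qmark v + 1 / 2 ^ Suc n" if "0 \<le> u" "u \<le> v" "v \<le> 1 / 2" for u v
    proof -
      have "qmark (u / (1 - u)) \<le> qmark (v / (1 - v)) + 1 / 2 ^ n"
        using Suc.IH unfold_lower_half_mono[OF that] that by simp
      then have "qmark (u / (1 - u)) / 2 \<le> qmark (v / (1 - v)) / 2 + 1 / 2 ^ Suc n" by simp
      then show ?thesis using qmark_lower_half[of u] qmark_lower_half[of v] that by linarith
    qed
    have pos: "0 < 1 / (2::real) ^ Suc n" by simp
    consider "y \<le> 1 / 2" | "1 / 2 \<le> x" | "x \<le> 1 / 2" "1 / 2 \<le> y" by linarith
    then show ?case
    proof cases
      case 1
      then show ?thesis using low Suc.prems by blast
    next
      case 2
      then show ?thesis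
        using low[of "1 - y" "1 - x"] Suc.prems qmark_reflect[of x] qmark_reflect[of y] by simp
    next
      case 3
      then show ?thesis
        using qmark_lower_half_le[of x] qmark_upper_half_ge[of y] Suc.prems pos by linarith
    qed
  qed
  from tendsto_add[OF tendsto_const const_over_power_two_tendsto_0[of 1]]
  have "(\<lambda>n. qmark y + 1 / 2 ^ n) \<longlonglongrightarrow> qmark y" by simp
  then show ?thesis using LIMSEQ_le_const * assms by blast
qed

lemma qmark_near_0: "0 \<le> x \<Longrightarrow> x \<le> 1 / 4 ^ n \<Longrightarrow> qmark x \<le> 1 / 2 ^ n"
proof (induction n arbitrary: x)
  case 0
  then show ?case using qmark_range[of x] by simp
next
  case (Suc n)
  have "(1::real) \<le> 4 ^ n" by simp
  then have "1 / (4::real) ^ Suc n \<le> 1 / 4" by (simp add: field_simps)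
  then have x: "x \<le> 1 / 4" using Suc.prems by linarith
  have "x / (1 - x) \<le> x / (1 / 4)" using x Suc.prems by (intro divide_left_mono) auto
  also have "\<dots> \<le> 1 / 4 ^ n" using Suc.prems by (simp add: field_simps)
  finally have "qmark (x / (1 - x)) \<le> 1 / 2 ^ n" using Suc.IH x Suc.prems by simp
  then show ?case using qmark_lower_half[of x] x Suc.prems by simp
qed

text \<open>
  The map \<open>u \<mapsto> u/(1-u)\<close> of \<open>[0,1/2]\<close> onto \<open>[0,1]\<close> stretches distances at most fourfold, while
  \<open>?\<close> halves. When \<open>1/2\<close> separates \<open>x\<close> and \<open>y\<close>, the induction hypothesis on either side would
  not suffice; the sharper bound near the end points is needed.
\<close>

lemma qmark_modulus:
  "0 \<le> x \<Longrightarrow> x \<le> y \<Longrightarrow> y \<le> 1 \<Longrightarrow> y - x \<le> 1 / 4 ^ n \<Longrightarrow> qmark y - qmark x \<le> 2 / 2 ^ n"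
proof (induction n arbitrary: x y)
  case 0
  then show ?case using qmark_range[of x] qmark_range[of y] by simp
next
  case (Suc n)
  have expand: "v / (1 - v) - u / (1 - u) \<le> 1 / 4 ^ n"
    if "0 \<le> u" "u \<le> v" "v \<le> 1 / 2" "v - u \<le> 1 / 4 ^ Suc n" for u v :: real
  proof -
    have "v / (1 - v) - u / (1 - u) = (v - u) / ((1 - v) * (1 - u))"
      using that by (simp add: field_simps)
    also have "\<dots> \<le> (v - u) / (1 / 2 * (1 / 2))"
      using that by (intro divide_left_mono mult_mono) auto
    finally show ?thesis using that by simp
  qed
  have low: "qmark v - qmark u \<le> 2 / 2 ^ Suc n"
    if "0 \<le> u" "u \<le> v" "v \<le> 1 / 2" "v - u \<le> 1 / 4 ^ Suc n" for u v
  proof -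
    have "qmark (v / (1 - v)) - qmark (u / (1 - u)) \<le> 2 / 2 ^ n"
      using Suc.IH expand[OF that] unfold_lower_half_mono[OF that(1-3)] that by simp
    then have "qmark (v / (1 - v)) / 2 - qmark (u / (1 - u)) / 2 \<le> 2 / 2 ^ Suc n" by simp
    then show ?thesis using qmark_lower_half[of u] qmark_lower_half[of v] that by linarith
  qed
  have half: "1 / 2 - qmark u \<le> 1 / 2 ^ Suc n"
    if u: "0 \<le> u" "u \<le> 1 / 2" "1 / 2 - u \<le> 1 / 4 ^ Suc n" for u
  proof -
    have "1 - u / (1 - u) \<le> 1 / 4 ^ n" using expand[of u "1 / 2"] u by simp
    moreover have "0 \<le> u / (1 - u)" "u / (1 - u) \<le> 1" using u by auto
    ultimately have "1 - qmark (u / (1 - u)) \<le> 1 / 2 ^ n"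
      using qmark_near_0[of "1 - u / (1 - u)" n] qmark_reflect[of "u / (1 - u)"] by simp
    then show ?thesis using qmark_lower_half[of u] u by (simp add: field_simps)
  qed
  consider "y \<le> 1 / 2" | "1 / 2 \<le> x" | "x \<le> 1 / 2" "1 / 2 \<le> y" by linarith
  then show ?case
  proof cases
    case 1
    then show ?thesis using low Suc.prems by blast
  next
    case 2
    then show ?thesis
      using low[of "1 - y" "1 - x"] Suc.prems qmark_reflect[of x] qmark_reflect[of y] by simp
  next
    case 3
    have "1 / 2 - qmark x \<le> 1 / 2 ^ Suc n" using half[of x] Suc.prems 3 by simp
    moreover have "1 / 2 - qmark (1 - y) \<le> 1 / 2 ^ Suc n" using half[of "1 - y"] Suc.prems 3 by simp
    moreover have "qmark (1 - y) = 1 - qmark y" using qmark_reflect[of y] Suc.prems by simp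
    ultimately show ?thesis by (simp add: field_simps)
  qed
qed

lemma continuous_on_qmark: "continuous_on {0..1} qmark"
  unfolding continuous_on_iff
proof (intro ballI allI impI)
  fix x e :: real assume x: "x \<in> {0..1}" and "0 < e"
  then obtain n where n: "(1 / 2) ^ n < e / 2" using real_arch_pow_inv[of "e / 2" "1 / 2"] by auto
  show "\<exists>d>0. \<forall>x'\<in>{0..1}. dist x' x < d \<longrightarrow> dist (qmark x') (qmark x) < e"
  proof (intro exI[of _ "1 / 4 ^ n"] conjI ballI impI)
    fix y :: real assume y: "y \<in> {0..1}" "dist y x < 1 / 4 ^ n"
    have "\<bar>qmark y - qmark x\<bar> \<le> 2 / 2 ^ n"
    proof (cases "x \<le> y")
      case True
      then show ?thesis using qmark_modulus[of x y n] qmark_mono[of x y] x y by (simp add: dist_real_def)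
    next
      case False
      then show ?thesis using qmark_modulus[of y x n] qmark_mono[of y x] x y by (simp add: dist_real_def)
    qed
    also have "\<dots> < e" using n by (simp add: power_one_over)
    finally show "dist (qmark y) (qmark x) < e" by (simp add: dist_real_def)
  qed simp
qed

lemma qmark_ivt:
  assumes "0 \<le> a" "a \<le> b" "b \<le> 1" "(qmark a - a) * (qmark b - b) \<le> 0"
  obtains s where "a \<le> s" "s \<le> b" "qmark s = s"
proof -
  have c: "continuous_on {a..b} (\<lambda>t. qmark t - t)"
    by (intro continuous_intros continuous_on_subset[OF continuous_on_qmark]) (use assms in auto)
  have "\<exists>s\<ge>a. s \<le> b \<and> qmark s - s = 0"
  proof (cases "qmark a - a \<le> 0 \<and> 0 \<le> qmark b - b")
    case True
    then show ?thesis using IVT'[OF _ _ assms(2) c, of 0] by blast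
  next
    case False
    then have "qmark b - b \<le> 0" "0 \<le> qmark a - a" using assms(4) by (auto simp: mult_le_0_iff)
    then show ?thesis using IVT2'[OF _ _ assms(2) c, of 0] by blast
  qed
  then show thesis using that by auto
qed

section \<open>Rational fixed points\<close>

text \<open>
  Undoing \<open>p/s \<mapsto> p/(p+s)\<close>, where \<open>p < s\<close>, less than halves the denominator and cancels exactly
  one factor \<open>1/2\<close> of the value. Hence the value at a reduced fraction is a reduced dyadic fraction
  whose denominator is larger than \<open>q\<close>, except at \<open>1/2\<close>.
\<close>

lemma qmark_rational_dyadic:
  assumes "0 < p" "p < q" "coprime p q"
  shows "\<exists>j k::nat. odd j \<and> 0 < k \<and> qmark (real p / real q) = real j / 2 ^ k \<and> (q < 2 ^ k \<or> q = 2)"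
  using assms
proof (induction q arbitrary: p rule: less_induct)
  case (less q)
  let ?P = "\<lambda>p. \<exists>j k::nat. odd j \<and> 0 < k \<and> qmark (real p / real q) = real j / 2 ^ k \<and> (q < 2 ^ k \<or> q = 2)"
  have low: "?P p" if p: "0 < p" "2 * p \<le> q" "coprime p q" for p
  proof (cases "2 * p = q")
    case True
    then have "p = 1" using p(3) coprime_common_divisor[of p q p] by auto
    then show ?thesis using True qmark_half by (intro exI[of _ 1]) auto
  next
    case False
    define s where "s = q - p"
    have q: "q = p + s" "p < s" using False p by (auto simp: s_def)
    have "coprime p s" using p(3) q(1) by (simp add: coprime_iff_gcd_eq_1)
    then obtain j k where jk: "odd j" "0 < k" "qmark (real p / real s) = real j / 2 ^ k"
      "s < 2 ^ k \<or> s = 2" using less.IH[of s p] p q by auto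
    have "qmark (real p / real q) = real j / 2 ^ Suc k"
      using qmark_fraction_lower_half[of p s] jk(3) q by simp
    moreover have "(2::nat) ^ 1 \<le> 2 ^ k" using jk(2) by (intro power_increasing) auto
    then have "q < 2 ^ Suc k" using jk(4) q by auto
    ultimately show ?thesis using jk(1) by blast
  qed
  show ?case
  proof (cases "2 * p \<le> q")
    case True
    then show ?thesis using low less.prems by blast
  next
    case False
    have "coprime (q - p) q" using less.prems
      by (metis coprime_iff_gcd_eq_1 gcd_diff2_nat less_imp_le_nat)
    moreover have "0 < q - p" "2 * (q - p) \<le> q" using False less.prems by auto
    ultimately obtain j k where jk: "odd j" "0 < k" "qmark (real (q - p) / real q) = real j / 2 ^ k"
      "q < 2 ^ k \<or> q = 2" using low[of "q - p"] by blast
    have eq: "real (q - p) / real q = 1 - real p / real q"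
      using less.prems by (simp add: of_nat_diff field_simps)
    have r: "qmark (real p / real q) = 1 - real j / 2 ^ k"
      using qmark_reflect[of "real p / real q"] jk(3) eq less.prems by simp
    have "0 \<le> qmark (real p / real q)" using qmark_range[of "real p / real q"] less.prems by simp
    then have "real j \<le> real (2 ^ k)" unfolding r by (simp add: field_simps)
    then have le: "j \<le> 2 ^ k" by (simp only: of_nat_le_iff)
    then have "real (2 ^ k - j) / 2 ^ k = qmark (real p / real q)"
      unfolding r by (simp add: of_nat_diff field_simps)
    moreover have "odd (2 ^ k - j)" using jk(1,2) le by simp
    ultimately show ?thesis using jk(2,4) by metis
  qed
qed

lemma qmark_rational_fixed_point:
  assumes "x \<in> \<rat>" "0 < x" "x < 1" "qmark x = x"
  shows "x = 1 / 2"
proof -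
  obtain p q :: nat where pq: "q \<noteq> 0" "\<bar>x\<bar> = real p / real q" "coprime p q"
    using Rats_abs_nat_div_natE[OF assms(1)] by metis
  then have x: "x = real p / real q" using assms by simp
  have "0 < p" "p < q" using assms(2,3) pq(1) unfolding x by (auto simp: field_simps zero_less_divide_iff)
  then obtain j k :: nat where jk: "odd j" "0 < k" "qmark (real p / real q) = real j / 2 ^ k"
    "q < 2 ^ k \<or> q = 2" using qmark_rational_dyadic pq(3) by blast
  have "real p / real q = real j / 2 ^ k" using jk(3) assms(4) x by simp
  then have "real (p * 2 ^ k) = real (j * q)" using pq(1) by (simp add: field_simps)
  then have eq: "p * 2 ^ k = j * q" by (simp only: of_nat_eq_iff)
  have "coprime j (2 ^ k)" using jk(1) by simp
  moreover have "2 ^ k dvd j * q" using eq by (metis dvd_triv_right)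
  ultimately have "2 ^ k dvd q" by (simp add: coprime_commute coprime_dvd_mult_right_iff)
  then have "2 ^ k \<le> q" using pq(1) dvd_imp_le by blast
  then have "q = 2" using jk(4) by auto
  then show ?thesis using x \<open>0 < p\<close> \<open>p < q\<close> by simp
qed

section \<open>Farey pairs\<close>

text \<open>
  Neighbouring fractions \<open>p/q < p'/q'\<close> in \<open>[0,1]\<close>. The determinant condition \<open>p'q - pq' = 1\<close> is
  written without subtraction; it makes \<open>q\<close>, \<open>p'\<close> positive and both fractions reduced, and
  \<open>p' \<le> q'\<close> then keeps both in the unit interval.
\<close>

definition farey_pair :: "nat \<Rightarrow> nat \<Rightarrow> nat \<Rightarrow> nat \<Rightarrow> bool" where
  "farey_pair p q p' q' \<longleftrightarrow> p' * q = p * q' + 1 \<and> p' \<le> q'"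

lemma farey_pairD:
  assumes "farey_pair p q p' q'"
  shows "p' * q = p * q' + 1" "p' \<le> q'" "0 < q" "0 < p'" "0 < q'" "p < q"
proof -
  show 1: "p' * q = p * q' + 1" "p' \<le> q'" using assms by (auto simp: farey_pair_def)
  then show "0 < q" "0 < p'" by (auto intro: gr0I)
  then show "0 < q'" using 1 by simp
  have "p * q' < p' * q" using 1 by simp
  also have "\<dots> \<le> q' * q" using 1(2) by (rule mult_le_mono1)
  finally show "p < q" by (simp add: mult.commute)
qed

lemma farey_pair_mediant:
  assumes "farey_pair p q p' q'"
  shows "farey_pair p q (p + p') (q + q')" "farey_pair (p + p') (q + q') p' q'"
  using farey_pairD[OF assms] by (auto simp: farey_pair_def algebra_simps)

lemma farey_pair_diff:
  assumes "farey_pair p q p' q'"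
  shows "real p' / real q' - real p / real q = 1 / (real q * real q')"
proof -
  note f = farey_pairD[OF assms]
  have "real (p' * q) = real (p * q' + 1)" using f(1) by (simp only:)
  then have "real p' * real q = real p * real q' + 1" by simp
  then show ?thesis using f(3,5) by (simp add: diff_frac_eq mult.commute)
qed

lemma farey_pair_coprime:
  assumes "farey_pair p q p' q'"
  shows "coprime p q" "coprime p' q'"
proof -
  note f = farey_pairD[OF assms]
  show "coprime p q"
  proof (rule coprimeI)
    fix c assume "c dvd p" "c dvd q"
    then have "c dvd p * q'" "c dvd p * q' + 1" using f(1) by (metis dvd_mult2, metis dvd_mult)
    then show "is_unit c" by (metis dvd_add_right_iff)
  qed
  show "coprime p' q'"
  proof (rule coprimeI)
    fix c assume "c dvd p'" "c dvd q'"
    then have "c dvd p * q'" "c dvd p * q' + 1" using f(1) by (metis dvd_mult, metis dvd_mult2)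
    then show "is_unit c" by (metis dvd_add_right_iff)
  qed
qed

lemma farey_pair_reflect:
  assumes "farey_pair p q p' q'"
  shows "farey_pair (q' - p') q' (q - p) q"
proof -
  note f = farey_pairD[OF assms]
  obtain s s' where s: "q = p + s" "q' = p' + s'" using f by (metis le_iff_add less_imp_le_nat)
  show ?thesis using f(1) unfolding s farey_pair_def by (simp add: algebra_simps)
qed

text \<open>The only Farey pair with \<open>1/2\<close> strictly inside is \<open>0/1\<close>, \<open>1/1\<close>.\<close>

lemma farey_pair_not_straddle:
  assumes "farey_pair p q p' q'" "2 * p < q" "q' < 2 * p'"
  shows "q = 1" "q' = 1"
proof -
  note f = farey_pairD[OF assms(1)]
  obtain a where a: "q = 2 * p + 1 + a"
    using assms(2) by (metis add.commute add.left_commute less_iff_Suc_add plus_1_eq_Suc)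
  obtain b where b: "2 * p' = q' + 1 + b"
    using assms(3) by (metis add.commute add.left_commute less_iff_Suc_add plus_1_eq_Suc)
  have "2 * p' * q = 2 * p * q' + 2" using f(1) by simp
  then have "(q' + 1 + b) * q = 2 * p * q' + 2" using b by simp
  then have "q' * (1 + a) + q + b * q = 2" unfolding a by (simp add: algebra_simps)
  moreover have "q' \<le> q' * (1 + a)" by simp
  ultimately have "q' + q \<le> 2" by linarith
  then show "q = 1" "q' = 1" using f by auto
qed

text \<open>
  A Farey pair in \<open>[0,1/2]\<close> is the image of one with smaller \<open>q + q'\<close> under the linear map
  \<open>(p,q) \<mapsto> (p,q+p)\<close>, which preserves mediants and along which \<open>?\<close> halves; a pair in \<open>[1/2,1]\<close> is
  reflected first.
\<close>

lemma qmark_mediant: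
  assumes "farey_pair p q p' q'"
  shows "qmark (real (p + p') / real (q + q')) = (qmark (real p / real q) + qmark (real p' / real q')) / 2"
  using assms
proof (induction "q + q'" arbitrary: p q p' q' rule: less_induct)
  case less
  have low: "qmark (real (a + a') / real (b + b')) = (qmark (real a / real b) + qmark (real a' / real b')) / 2"
    if ab: "farey_pair a b a' b'" "2 * a' \<le> b'" "b + b' = q + q'" for a b a' b'
  proof -
    note f = farey_pairD[OF ab(1)]
    obtain s s' where s: "b = a + s" "b' = a' + s'" using f by (metis le_iff_add less_imp_le_nat)
    have pr: "farey_pair a s a' s'"
      using f(1) ab(2) unfolding s farey_pair_def by (simp add: algebra_simps)
    note g = farey_pairD[OF pr]
    have IH: "qmark (real (a + a') / real (s + s')) = (qmark (real a / real s) + qmark (real a' / real s')) / 2"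
      using less.hyps[OF _ pr] f(4) s ab(3) by simp
    note step = qmark_fraction_lower_half
    have "qmark (real (a + a') / real (b + b')) = qmark (real (a + a') / real (s + s')) / 2"
      using step[of "a + a'" "s + s'"] g s by (simp add: algebra_simps)
    then show ?thesis using IH step[of a s] step[of a' s'] g s by simp
  qed
  note f = farey_pairD[OF less.prems]
  consider "2 * p' \<le> q'" | "q \<le> 2 * p" | "q = 1" "q' = 1"
    using farey_pair_not_straddle[OF less.prems] by linarith
  then show ?case
  proof cases
    case 1
    then show ?thesis using low less.prems by blast
  next
    case 2
    have r: "qmark (real (d - c) / real d) = 1 - qmark (real c / real d)" if "c \<le> d" "0 < d" for c d
    proof -
      have "real (d - c) / real d = 1 - real c / real d" using that by (simp add: of_nat_diff field_simps)
      then show ?thesis using qmark_reflect[of "real c / real d"] that by simp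
    qed
    have "qmark (real (q' - p' + (q - p)) / real (q' + q)) =
        (qmark (real (q' - p') / real q') + qmark (real (q - p) / real q)) / 2"
      using low[OF farey_pair_reflect[OF less.prems]] 2 by simp
    moreover have "q' - p' + (q - p) = (q + q') - (p + p')" "q' + q = q + q'" using f by auto
    ultimately have "1 - qmark (real (p + p') / real (q + q')) =
        (1 - qmark (real p' / real q') + (1 - qmark (real p / real q))) / 2"
      using r[of "p + p'" "q + q'"] r[of p q] r[of p' q'] f by simp
    then show ?thesis by (simp add: field_simps)
  next
    case 3
    then have "p = 0" "p' = 1" using f by auto
    then show ?thesis using 3 qmark_half qmark_0 qmark_1 by simp
  qed
qed

section \<open>Approximating irrational numbers\<close>

lemma irrational_in_farey_pair:
  assumes "x \<notin> \<rat>" "0 < x" "x < 1"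
  shows "\<exists>p q p' q'. farey_pair p q p' q' \<and> real p / real q < x \<and> x < real p' / real q' \<and> n + 2 \<le> q + q'"
proof (induction n)
  case 0
  then show ?case using assms by (intro exI[of _ 0] exI[of _ 1]) (simp add: farey_pair_def)
next
  case (Suc n)
  then obtain p q p' q' where h: "farey_pair p q p' q'" "real p / real q < x" "x < real p' / real q'"
    "n + 2 \<le> q + q'" by blast
  note f = farey_pairD[OF h(1)]
  have "x \<noteq> real (p + p') / real (q + q')" using assms(1) by auto
  then consider "x < real (p + p') / real (q + q')" | "real (p + p') / real (q + q') < x" by linarith
  then show ?case
  proof cases
    case 1
    then show ?thesis using farey_pair_mediant(1)[OF h(1)] h f
      by (intro exI[of _ p] exI[of _ q] exI[of _ "p + p'"] exI[of _ "q + q'"]) auto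
  next
    case 2
    then show ?thesis using farey_pair_mediant(2)[OF h(1)] h f
      by (intro exI[of _ "p + p'"] exI[of _ "q + q'"] exI[of _ p'] exI[of _ q']) auto
  qed
qed

lemma farey_pair_width:
  assumes "farey_pair p q p' q'" "n + 2 \<le> q + q'"
  shows "real p' / real q' - real p / real q \<le> 1 / real (n + 1)"
proof -
  note f = farey_pairD[OF assms(1)]
  obtain a b where "q = Suc a" "q' = Suc b" using f by (metis Suc_pred)
  then have "n + 1 \<le> q * q'" using assms(2) by simp
  then have "real (n + 1) \<le> real q * real q'" by (metis of_nat_le_iff of_nat_mult)
  then show ?thesis unfolding farey_pair_diff[OF assms(1)] by (intro divide_left_mono) (use f in auto)
qed

text \<open>
  If \<open>x\<close> were always to the left of the mediant, the left end \<open>l\<close> would never move while the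
  intervals shrink, and \<open>x = l\<close> would be rational.
\<close>

lemma irrational_right_of_mediant:
  assumes "x \<notin> \<rat>" "0 < x" "x < 1"
  obtains p q p' q' where "farey_pair p q p' q'" "real (p + p') / real (q + q') < x"
    "x < real p' / real q'" "n + 2 \<le> q + q'"
proof -
  obtain p q p' q' where h: "farey_pair p q p' q'" "real p / real q < x" "x < real p' / real q'"
    "n + 2 \<le> q + q'" using irrational_in_farey_pair[OF assms] by blast
  have "\<exists>p q p' q'. farey_pair p q p' q' \<and> real (p + p') / real (q + q') < x \<and>
      x < real p' / real q' \<and> n + 2 \<le> q + q'"
  proof (rule ccontr)
    assume no: "\<not> ?thesis"
    have ex: "\<exists>a b. farey_pair p q a b \<and> x < real a / real b \<and> n + k + 2 \<le> q + b" for k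
    proof (induction k)
      case 0
      then show ?case using h by auto
    next
      case (Suc k)
      then obtain a b where ab: "farey_pair p q a b" "x < real a / real b" "n + k + 2 \<le> q + b" by blast
      have "x \<noteq> real (p + a) / real (q + b)" using assms(1) by auto
      moreover have "\<not> real (p + a) / real (q + b) < x"
      proof
        assume "real (p + a) / real (q + b) < x"
        moreover have "n + 2 \<le> q + b" using ab(3) by simp
        ultimately show False using no ab(1,2) by blast
      qed
      ultimately have "x < real (p + a) / real (q + b)" by linarith
      moreover have "n + Suc k + 2 \<le> q + (q + b)" using ab(3) farey_pairD[OF ab(1)] by simp
      ultimately show ?case using farey_pair_mediant(1)[OF ab(1)] by blast
    qed
    have *: "x - real p / real q < 1 / real (n + k + 1)" for k
    proof -
      obtain a b where ab: "farey_pair p q a b" "x < real a / real b" "n + k + 2 \<le> q + b"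
        using ex[of k] by blast
      show ?thesis using farey_pair_width[OF ab(1,3)] ab(2) by linarith
    qed
    obtain k where "1 / real (Suc k) < x - real p / real q"
      using h(2) nat_approx_posE[of "x - real p / real q"] by auto
    moreover have "1 / real (n + k + 1) \<le> 1 / real (Suc k)" by (intro divide_left_mono) auto
    ultimately show False using *[of k] by linarith
  qed
  then show thesis using that by blast
qed

lemma irrational_away_from_small_denominators:
  fixes x :: real
  assumes "x \<notin> \<rat>"
  obtains d where "0 < d" "\<And>p q::nat. p \<le> q \<Longrightarrow> q < N \<Longrightarrow> d \<le> \<bar>x - real p / real q\<bar>"
proof -
  define S where "S = (\<lambda>(p, q). real p / real q) ` ({..N} \<times> {..N})"
  have "finite S" by (simp add: S_def)
  then obtain d where d: "d > 0" "\<And>y. y \<in> S \<Longrightarrow> y \<noteq> x \<Longrightarrow> d \<le> dist x y"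
    using finite_set_avoid[of S x] by blast
  have "d \<le> \<bar>x - real p / real q\<bar>" if "p \<le> q" "q < N" for p q :: nat
  proof -
    have "real p / real q \<in> S" using that unfolding S_def by (intro image_eqI[of _ _ "(p, q)"]) auto
    moreover have "real p / real q \<noteq> x" using assms by auto
    ultimately show ?thesis using d(2) by (simp add: dist_real_def)
  qed
  then show thesis using that d(1) by blast
qed

section \<open>Fixed points as upward crossings\<close>

text \<open>
  At reduced fractions \<open>p/q\<close> in \<open>(0,1)\<close> with \<open>q \<ge> q0\<close>, the question mark function differs from the
  identity by more than \<open>1/(2q\<^sup>2)\<close>.
\<close>

definition avoids_diagonal :: "nat \<Rightarrow> bool" where
  "avoids_diagonal q0 \<longleftrightarrow> (\<forall>p q::nat. 0 < p \<longrightarrow> 0 < q \<longrightarrow> coprime p q \<longrightarrow> p < q \<longrightarrow> q0 \<le> q \<longrightarrow>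
     \<bar>qmark (real p / real q) - real p / real q\<bar> > 1 / (2 * (real q)\<^sup>2))"

text \<open>
  The names in the proof: \<open>l < m < m2 < r\<close> are the left end, the mediant, the mediant of \<open>m\<close> and
  \<open>r\<close>, and the right end; \<open>a\<close> and \<open>b\<close> are the denominators of \<open>l\<close> and \<open>r\<close>.
\<close>

lemma above_diagonal_at_right_endpoint:
  assumes H: "avoids_diagonal q0"
    and fp: "farey_pair p q p' q'"
    and x: "real (p + p') / real (q + q') < x" "x < real p' / real q'"
    and fix_x: "qmark x = x"
    and pos: "0 < p" "p' < q'" and den: "q0 \<le> q" "q0 \<le> q'"
  shows "real p' / real q' < qmark (real p' / real q')"
proof (rule ccontr)
  assume nle: "\<not> ?thesis"
  note f = farey_pairD[OF fp]
  define a b where "a = real q" and "b = real q'"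
  have ab: "0 < a" "0 < b" using f by (auto simp: a_def b_def)
  define l r where "l = real p / real q" and "r = real p' / real q'"
  define m m2 where "m = real (p + p') / real (q + q')" and "m2 = real (p + p' + p') / real (q + q' + q')"
  note fp1 = farey_pair_mediant(2)[OF fp]
  note fp2 = farey_pair_mediant(2)[OF fp1]
  have rl: "r - l = 1 / (a * b)" using farey_pair_diff[OF fp] by (simp add: a_def b_def l_def r_def)
  have rm: "r - m = 1 / ((a + b) * b)"
    using farey_pair_diff[OF fp1] by (simp add: a_def b_def m_def r_def)
  have rm2: "r - m2 = 1 / ((a + b + b) * b)"
    using farey_pair_diff[OF fp2] by (simp add: a_def b_def m2_def r_def)
  have mr: "m < x" "x < r" using x by (auto simp: m_def r_def)
  have lm: "l < m"
    using farey_pair_diff[OF farey_pair_mediant(1)[OF fp]] f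
    by (smt (verit) divide_pos_pos l_def m_def of_nat_0_less_iff add_gr_0 mult_pos_pos zero_less_one)
  have l0: "0 \<le> l" and r1: "r \<le> 1" using f by (auto simp: l_def r_def)
  have r_off: "1 / (2 * b\<^sup>2) < \<bar>qmark r - r\<bar>" and l_off: "1 / (2 * a\<^sup>2) < \<bar>qmark l - l\<bar>"
    using H f pos den farey_pair_coprime[OF fp]
    unfolding avoids_diagonal_def a_def b_def l_def r_def by auto
  have x_le: "x \<le> qmark r" and x_ge: "qmark l \<le> x"
    using qmark_mono[of x r] qmark_mono[of l x] fix_x mr lm l0 r1 by auto
  have r_below: "qmark r < r - 1 / (2 * b\<^sup>2)" using r_off nle unfolding r_def by linarith
  have r_far: "1 / (2 * b\<^sup>2) < r - x" using r_below x_le by linarith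
  \<comment> \<open>The neighbourhoods of radius \<open>1/(2a\<^sup>2)\<close> of \<open>l\<close> and \<open>1/(2b\<^sup>2)\<close> of \<open>r\<close> cover \<open>[l,r]\<close>.\<close>
  have "0 \<le> (a - b)\<^sup>2 / (2 * a\<^sup>2 * b\<^sup>2)" by simp
  also have "\<dots> = 1 / (2 * a\<^sup>2) + 1 / (2 * b\<^sup>2) - 1 / (a * b)"
    using ab by (simp add: field_simps power2_eq_square)
  finally have "1 / (a * b) - 1 / (2 * b\<^sup>2) \<le> 1 / (2 * a\<^sup>2)" by simp
  then have l_near: "x - l < 1 / (2 * a\<^sup>2)" using r_far rl by linarith
  then have l_below: "1 / (2 * a\<^sup>2) < x - qmark l" using l_off x_ge mr lm by linarith
  have "2 * b\<^sup>2 \<le> (a + b + b) * b" using ab by (simp add: power2_eq_square algebra_simps)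
  then have "1 / ((a + b + b) * b) \<le> 1 / (2 * b\<^sup>2)" using ab by (intro frac_le) auto
  then have "x < m2" using r_far rm2 by linarith
  moreover have "m2 \<le> r" using rm2 ab by (smt (verit) divide_pos_pos mult_pos_pos)
  ultimately have "x \<le> qmark m2" using qmark_mono[of x m2] fix_x mr lm l0 r1 by auto
  moreover have "qmark m = (qmark l + qmark r) / 2"
    using qmark_mediant[OF fp] by (simp add: m_def l_def r_def)
  moreover have "qmark m2 = (qmark m + qmark r) / 2"
    using qmark_mediant[OF fp1] by (simp add: m_def m2_def r_def)
  ultimately have "(qmark r - qmark l) / 4 \<le> qmark r - x" by argo
  then have "1 / (8 * a\<^sup>2) < 1 / ((a + b) * b) - 1 / (2 * b\<^sup>2)"
    using l_below x_le r_below rm mr by simp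
  moreover have "a + b \<noteq> 0" using ab by simp
  then have "1 / ((a + b) * b) - 1 / (2 * b\<^sup>2) - 1 / (8 * a\<^sup>2) =
      - (b ^ 3 + a * (b - 2 * a)\<^sup>2) / (8 * a\<^sup>2 * b\<^sup>2 * (a + b))"
    using ab by (simp add: divide_simps) (simp add: algebra_simps power2_eq_square power3_eq_cube)
  ultimately have "0 < - (b ^ 3 + a * (b - 2 * a)\<^sup>2) / (8 * a\<^sup>2 * b\<^sup>2 * (a + b))" by linarith
  moreover have "0 < 8 * a\<^sup>2 * b\<^sup>2 * (a + b)" using ab by simp
  ultimately have "b ^ 3 + a * (b - 2 * a)\<^sup>2 < 0" by (simp add: zero_less_divide_iff)
  moreover have "0 < b ^ 3" "0 \<le> a * (b - 2 * a)\<^sup>2" using ab by auto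
  ultimately show False by linarith
qed

lemma above_diagonal_right_of_fixed_point:
  assumes H: "avoids_diagonal q0"
    and x: "x \<notin> \<rat>" "0 < x" "x < 1" "qmark x = x" and e: "0 < e"
  obtains z where "x < z" "z < x + e" "z \<le> 1" "z < qmark z"
proof -
  \<comment> \<open>Denominators at least \<open>2\<close> keep the ends away from \<open>0\<close> and \<open>1\<close>, where the hypothesis is silent.\<close>
  obtain d where d: "0 < d" "\<And>p q::nat. p \<le> q \<Longrightarrow> q < max q0 2 \<Longrightarrow> d \<le> \<bar>x - real p / real q\<bar>"
    using irrational_away_from_small_denominators[OF x(1)] by metis
  obtain n where n: "1 / real (Suc n) < min d e" using nat_approx_posE[of "min d e"] d(1) e by auto
  obtain p q p' q' where h: "farey_pair p q p' q'" "real (p + p') / real (q + q') < x"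
    "x < real p' / real q'" "n + 2 \<le> q + q'" using irrational_right_of_mediant[OF x(1-3)] by metis
  note f = farey_pairD[OF h(1)]
  have w: "real p' / real q' - real p / real q < min d e"
    using farey_pair_width[OF h(1,4)] n by simp
  have lm: "real p / real q < real (p + p') / real (q + q')"
    using farey_pair_diff[OF farey_pair_mediant(1)[OF h(1)]] f
    by (smt (verit) divide_pos_pos of_nat_0_less_iff add_gr_0 mult_pos_pos zero_less_one)
  have "\<bar>x - real p / real q\<bar> < d" "\<bar>x - real p' / real q'\<bar> < d" using w h(2,3) lm by auto
  then have den: "max q0 2 \<le> q" "max q0 2 \<le> q'" using d(2)[of p q] d(2)[of p' q'] f by fastforce+
  have "0 < p" using f(1) den by (cases p) auto
  moreover have "p' \<noteq> q'"
  proof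
    assume "p' = q'"
    then have "q' * q = q' * p + 1" using f(1) by (simp add: mult.commute)
    then have "q' dvd 1" by (metis dvd_add_right_iff dvd_triv_left)
    then show False using den by simp
  qed
  then have "p' < q'" using f(2) by simp
  ultimately have "real p' / real q' < qmark (real p' / real q')"
    using above_diagonal_at_right_endpoint[OF H h(1-3) x(4)] den by simp
  moreover have "real p' / real q' < x + e" using w h(2) lm by simp
  moreover have "real p' / real q' \<le> 1" using f by simp
  ultimately show thesis using that h(3) by blast
qed

lemma below_diagonal_left_of_fixed_point:
  assumes H: "avoids_diagonal q0"
    and x: "x \<notin> \<rat>" "0 < x" "x < 1" "qmark x = x" and e: "0 < e"
  obtains z where "x - e < z" "z < x" "0 \<le> z" "qmark z < z"
proof -
  have "1 - x \<notin> \<rat>" using x(1) Rats_diff[of 1 "1 - x"] by auto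
  then obtain z where z: "1 - x < z" "z < 1 - x + e" "z \<le> 1" "z < qmark z"
    using above_diagonal_right_of_fixed_point[OF H, of "1 - x" e] x e qmark_reflect[of x] by auto
  then show thesis using that[of "1 - z"] qmark_reflect[of z] x by auto
qed

section \<open>Counting the fixed points\<close>

lemma fixed_point_lower_half_exists:
  obtains x where "0 < x" "x < 1 / 2" "qmark x = x"
proof -
  have "qmark (1 / 3) = 1 / 4" using qmark_lower_half[of "1 / 3"] qmark_half by simp
  then have q4: "qmark (1 / 4) = 1 / 8" using qmark_lower_half[of "1 / 4"] by simp
  then have "qmark (3 / 4) = 7 / 8" using qmark_reflect[of "1 / 4"] by simp
  then have q37: "qmark (3 / 7) = 7 / 16" using qmark_lower_half[of "3 / 7"] by simp
  obtain s where "1 / 4 \<le> s" "s \<le> 3 / 7" "qmark s = s"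
    using qmark_ivt[of "1 / 4" "3 / 7"] q4 q37 by auto
  then show thesis using that[of s] by simp
qed

lemma fixed_point_lower_half_unique:
  assumes H: "avoids_diagonal q0"
    and x: "0 < x" "qmark x = x" and y: "x < y" "y < 1 / 2" "qmark y = y"
  shows False
proof -
  have irr: "w \<notin> \<rat>" if "0 < w" "w < 1 / 2" "qmark w = w" for w
    using qmark_rational_fixed_point[of w] that by auto
  have "x \<notin> \<rat>" using irr x y by auto
  then obtain z where z: "x < z" "z < y" "z < qmark z"
    using above_diagonal_right_of_fixed_point[OF H, of x "y - x"] x y by auto
  \<comment> \<open>The first fixed point after \<open>z\<close>.\<close>
  define S where "S = {t \<in> {z..y}. qmark t - t = 0}"
  have "closed S" unfolding S_def
    by (intro continuous_closed_preimage_constant continuous_intros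
        continuous_on_subset[OF continuous_on_qmark]) (use x y z in auto)
  moreover have "y \<in> S" using y z by (auto simp: S_def)
  moreover have bdd: "bdd_below S" by (rule bdd_belowI[of _ z]) (auto simp: S_def)
  ultimately have "Inf S \<in> S" using closed_contains_Inf by blast
  define w where "w = Inf S"
  have w: "z \<le> w" "w \<le> y" "qmark w = w" using \<open>Inf S \<in> S\<close> by (auto simp: w_def S_def)
  have "z < w" using w z by (cases "z = w") auto
  have "w \<notin> \<rat>" using irr w x y z by auto
  then obtain t where t: "z < t" "t < w" "qmark t < t"
    using below_diagonal_left_of_fixed_point[OF H, of w "w - z"] w x y z \<open>z < w\<close> by auto
  obtain s where s: "z \<le> s" "s \<le> t" "qmark s = s"
    using qmark_ivt[of z t] t w x y z by (auto simp: mult_le_0_iff)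
  then have "s \<in> S" using t w by (auto simp: S_def)
  then have "w \<le> s" unfolding w_def using bdd by (rule cInf_lower)
  then show False using s t by simp
qed

theorem theorem4:
  assumes "\<exists>q0::nat. q0 > 0 \<and>
    (\<forall>p q::nat. 0 < p \<longrightarrow> 0 < q \<longrightarrow> coprime p q \<longrightarrow> p < q \<longrightarrow> q0 \<le> q \<longrightarrow>
       \<bar>qmark (real p / real q) - real p / real q\<bar> > 1 / (2 * (real q)\<^sup>2))"
  shows "card {x \<in> {0..1::real}. qmark x = x} = 5 \<and>
    (\<exists>!x::real. x \<in> {0<..<1/2} \<and> x \<notin> \<rat> \<and> qmark x = x)"
proof -
  obtain q0 where H: "avoids_diagonal q0" using assms unfolding avoids_diagonal_def by blast
  obtain x where x: "0 < x" "x < 1 / 2" "qmark x = x" using fixed_point_lower_half_exists .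
  have uniq: "y = x" if "0 < y" "y < 1 / 2" "qmark y = y" for y
    using fixed_point_lower_half_unique[OF H, of x y] fixed_point_lower_half_unique[OF H, of y x]
      x that by (meson linorder_neqE_linordered_idom)
  have irr: "x \<notin> \<rat>" using qmark_rational_fixed_point[of x] x by auto
  have "{y \<in> {0..1}. qmark y = y} = {0, x, 1 / 2, 1 - x, 1}"
  proof (intro equalityI)
    show "{y \<in> {0..1}. qmark y = y} \<subseteq> {0, x, 1 / 2, 1 - x, 1}"
    proof
      fix y assume "y \<in> {y \<in> {0..1}. qmark y = y}"
      then have y: "0 \<le> y" "y \<le> 1" "qmark y = y" by auto
      consider "y = 0" | "0 < y" "y < 1 / 2" | "y = 1 / 2" | "1 / 2 < y" "y < 1" | "y = 1"
        using y by linarith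
      then show "y \<in> {0, x, 1 / 2, 1 - x, 1}"
      proof cases
        case 2
        then show ?thesis using uniq y by blast
      next
        case 4
        then have "1 - y = x" using uniq[of "1 - y"] qmark_reflect[of y] y by simp
        then show ?thesis by auto
      qed auto
    qed
    show "{0, x, 1 / 2, 1 - x, 1} \<subseteq> {y \<in> {0..1}. qmark y = y}"
      using x by (simp add: qmark_0 qmark_1 qmark_half qmark_reflect)
  qed
  moreover have "card {0, x, 1 / 2, 1 - x, 1} = 5" using x by (simp add: card_insert_if)
  ultimately have "card {y \<in> {0..1}. qmark y = y} = 5" by (simp only:)
  moreover have "\<exists>!x::real. x \<in> {0<..<1/2} \<and> x \<notin> \<rat> \<and> qmark x = x"
  proof (rule ex1I[of _ x])
    show "x \<in> {0<..<1/2} \<and> x \<notin> \<rat> \<and> qmark x = x" using x irr by simp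
    show "y = x" if "y \<in> {0<..<1/2} \<and> y \<notin> \<rat> \<and> qmark y = y" for y
      using that uniq[of y] by simp
  qed
  ultimately show ?thesis by blast
qed

end
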